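(* Let $t\ge 3$ be an integer and let $C_t$ be the cycle graph on $t$ vertices. If $\Gamma$ is a finite simple graph with $A(\Gamma;x)=A(C_t;x)$, then $\Gamma$ is isomorphic to $C_t$.
   Context: All graphs are finite and simple with at least one vertex. For a graph $\Gamma=(V,E)$ of order $n$, a vertex $v$ and $X\subseteq V$, let $\delta_X(v)$ be the number of neighbours of $v$ in $X$, $\delta_1$ the maximum degree, and $\bar S=V\setminus S$. Let $\mathcal{K}=[-\delta_1,\delta_1]\cap\mathbb{Z}$. A nonempty $S\subseteq V$ is a defensive $k$-alliance if $\delta_S(v)\ge\delta_{\bar S}(v)+k$ for all $v\in S$. The exact index of alliance of a nonempty $S$ is $k_S=\max\{k\in\mathcal{K}: S \text{ is a defensive } k\text{-alliance}\}$ (equivalently $k_S=\min_{v\in S}(\delta_S(v)-\delta_{\bar S}(v))$). The alliance polynomial is $A(\Gamma;x)=\sum_{S} x^{n+k_S}$, the sum over all nonempty $S\subseteq V$ whose induced subgraph $\langle S\rangle$ is connected. *)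

theory Defs
  imports "Graph_Theory.Graph_Theory" "HOL-Computational_Algebra.Polynomial"
begin

text \<open>
  A finite simple graph is a \<^locale>\<open>graph\<close> of the Graph Theory entry: a finite, symmetric digraph
  without loops and parallel arcs, so that an undirected edge is a pair of opposite arcs.
\<close>

definition nbrs_in :: "('a, 'b) pre_digraph \<Rightarrow> 'a set \<Rightarrow> 'a \<Rightarrow> nat" where
  "nbrs_in G X v = card {u \<in> X. v \<rightarrow>\<^bsub>G\<^esub> u}"

text \<open>In a symmetric digraph without parallel arcs, the out-degree is the degree of the graph.\<close>

definition max_degree :: "('a, 'b) pre_digraph \<Rightarrow> nat" where
  "max_degree G = Max (out_degree G ` verts G)"

definition defensive_alliance :: "('a, 'b) pre_digraph \<Rightarrow> int \<Rightarrow> 'a set \<Rightarrow> bool" where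
  "defensive_alliance G k S \<longleftrightarrow> S \<noteq> {} \<and> S \<subseteq> verts G \<and>
     (\<forall>v\<in>S. int (nbrs_in G S v) \<ge> int (nbrs_in G (verts G - S) v) + k)"

definition exact_index :: "('a, 'b) pre_digraph \<Rightarrow> 'a set \<Rightarrow> int" where
  "exact_index G S =
     Max {k \<in> {- int (max_degree G)..int (max_degree G)}. defensive_alliance G k S}"

text \<open>
  The exponent is positive, so \<^const>\<open>nat\<close> does not truncate: the exact index is at least minus
  the maximum degree, which is smaller than the order.
\<close>

definition alliance_poly :: "('a, 'b) pre_digraph \<Rightarrow> int poly" where
  "alliance_poly G =
     (\<Sum>S | S \<subseteq> verts G \<and> S \<noteq> {} \<and> connected (G \<restriction> S).
        monom 1 (nat (int (card (verts G)) + exact_index G S)))"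

text \<open>This is the cycle on \<open>t\<close> vertices only for \<open>t \<ge> 3\<close>; for \<open>t = 1\<close> it would have a loop.\<close>

definition cycle_graph :: "nat \<Rightarrow> nat pair_pre_digraph" where
  "cycle_graph t = \<lparr> pverts = {..<t},
     parcs = {(i, j). i < t \<and> j < t \<and> (j = (i + 1) mod t \<or> i = (j + 1) mod t)} \<rparr>"

end

theory Submission
  imports Defs
begin

text \<open>
  The lowest term of the alliance polynomial has exponent \<open>n - \<delta>\<^sub>1\<close> and counts the vertices of maximum
  degree, since only singletons reach the index \<open>- \<delta>\<^sub>1\<close>. For the cycle the indices that occur are
  \<open>-2\<close>, \<open>0\<close> and \<open>2\<close>, the last one only for the whole vertex set. So \<open>\<Gamma>\<close> has maximum degree
  \<open>\<delta>\<^sub>1 = n - t + 2 \<ge> 2\<close>, attained by \<open>t\<close> vertices, its indices lie in \<open>{- \<delta>\<^sub>1, 2 - \<delta>\<^sub>1, 4 - \<delta>\<^sub>1}\<close>, and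
  \<open>4 - \<delta>\<^sub>1\<close> occurs exactly once. The index of a component is its minimum degree, which is nonnegative
  and hence equal to \<open>4 - \<delta>\<^sub>1\<close>; so \<open>\<delta>\<^sub>1 \<le> 4\<close> and \<open>\<Gamma>\<close> is connected. If \<open>\<delta>\<^sub>1 = 4\<close> there is an isolated
  vertex, which is absurd. If \<open>\<delta>\<^sub>1 = 3\<close> there is one leaf, all other degrees are 3, and deleting the
  leaf gives a second connected set of index \<open>1\<close>. Hence \<open>\<delta>\<^sub>1 = 2\<close>, and \<open>\<Gamma>\<close> is a connected 2-regular
  graph on \<open>t\<close> vertices.
\<close>

section \<open>Connectedness through closed vertex sets\<close>

text \<open>In a graph, where adjacency is symmetric, the closed subsets \<open>T\<close> of
  \<open>S\<close> are the unions of components of the subgraph induced by \<open>S\<close>.\<close>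

definition closed_in :: "('a, 'b) pre_digraph \<Rightarrow> 'a set \<Rightarrow> 'a set \<Rightarrow> bool" where
  "closed_in G S T \<longleftrightarrow> T \<subseteq> S \<and> (\<forall>u\<in>T. \<forall>v\<in>S. u \<rightarrow>\<^bsub>G\<^esub> v \<longrightarrow> v \<in> T)"

definition connected_sets :: "('a, 'b) pre_digraph \<Rightarrow> 'a set set" where
  "connected_sets G = {S. S \<subseteq> verts G \<and> S \<noteq> {} \<and> connected (G \<restriction> S)}"

text \<open>For a graph of order \<open>n\<close> this is the coefficient of the polynomial at
  exponent \<open>n + k\<close>. Indexing by the integer \<open>k\<close> leaves the order out of
  the counts.\<close>

definition index_count :: "('a, 'b) pre_digraph \<Rightarrow> int \<Rightarrow> nat" where
  "index_count G k = card {S \<in> connected_sets G. exact_index G S = k}"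

lemma arcs_ends_induce_subgraph:
  "arcs_ends (G \<restriction> S) = {(u, v). u \<rightarrow>\<^bsub>G\<^esub> v \<and> u \<in> S \<and> v \<in> S}"
  by (auto simp: arcs_ends_conv)

context graph
begin

lemma adj_sym: "u \<rightarrow>\<^bsub>G\<^esub> v \<longleftrightarrow> v \<rightarrow>\<^bsub>G\<^esub> u"
  using arcs_ends_symmetric[OF sym_arcs] by blast

text \<open>The set reachable from a vertex inside \<open>S\<close> is closed, and a closed set
  contains everything reachable from its members. Later connectivity arguments thus need no
  paths.\<close>

lemma connected_induce_iff:
  assumes "S \<subseteq> verts G"
  shows "connected (G \<restriction> S) \<longleftrightarrow> S \<noteq> {} \<and> (\<forall>T. closed_in G S T \<longrightarrow> T \<noteq> {} \<longrightarrow> T = S)"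
    (is "_ \<longleftrightarrow> _ \<and> ?C")
proof -
  interpret H: wf_digraph "G \<restriction> S" using assms by auto
  define R where "R = (arcs_ends (G \<restriction> S))\<^sup>s"
  have R: "(u, v) \<in> R \<longleftrightarrow> u \<rightarrow>\<^bsub>G\<^esub> v \<and> u \<in> S \<and> v \<in> S" for u v
    using adj_sym by (auto simp: R_def symcl_def arcs_ends_induce_subgraph)
  have conn: "connected (G \<restriction> S) \<longleftrightarrow> S \<noteq> {} \<and> (\<forall>u\<in>S. \<forall>v\<in>S. (u, v) \<in> rtrancl_on S R)"
    using connected_conv[of "G \<restriction> S"] by (simp add: R_def)
  have "?C \<longleftrightarrow> (\<forall>u\<in>S. \<forall>v\<in>S. (u, v) \<in> rtrancl_on S R)"
  proof
    assume ?C
    show "\<forall>u\<in>S. \<forall>v\<in>S. (u, v) \<in> rtrancl_on S R"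
    proof (rule ballI)
      fix u assume u: "u \<in> S"
      let ?T = "{v \<in> S. (u, v) \<in> rtrancl_on S R}"
      have "closed_in G S ?T"
        unfolding closed_in_def by (auto intro: rtrancl_on_into_rtrancl_on simp: R)
      moreover have "u \<in> ?T" using u by auto
      ultimately have "?T = S" using \<open>?C\<close> by blast
      then show "\<forall>v\<in>S. (u, v) \<in> rtrancl_on S R" by blast
    qed
  next
    assume reach: "\<forall>u\<in>S. \<forall>v\<in>S. (u, v) \<in> rtrancl_on S R"
    show ?C
    proof (intro allI impI)
      fix T assume T: "closed_in G S T" "T \<noteq> {}"
      then obtain u where u: "u \<in> T" "u \<in> S" by (auto simp: closed_in_def)
      have "v \<in> T" if "v \<in> S" for v
      proof -
        have "(u, v) \<in> rtrancl_on S R" using reach u that by blast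
        then show ?thesis
          by (induct rule: rtrancl_on_induct) (use u T in \<open>auto simp: closed_in_def R\<close>)
      qed
      then show "T = S" using T by (auto simp: closed_in_def)
    qed
  qed
  then show ?thesis using conn by simp
qed

lemma connected_sets_iff:
  "S \<in> connected_sets G \<longleftrightarrow> S \<subseteq> verts G \<and> S \<noteq> {} \<and> (\<forall>T. closed_in G S T \<longrightarrow> T \<noteq> {} \<longrightarrow> T = S)"
  using connected_induce_iff by (auto simp: connected_sets_def)

lemma finite_connected_sets: "finite (connected_sets G)"
  by (rule finite_subset[of _ "Pow (verts G)"]) (auto simp: connected_sets_def)

lemma singleton_connected: "v \<in> verts G \<Longrightarrow> {v} \<in> connected_sets G"
  by (auto simp: connected_sets_iff closed_in_def)

text \<open>A nonempty closed subset of least cardinality is connected, because a set closed inside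
  it is again closed in the whole graph.\<close>

lemma closed_contains_component:
  assumes "closed_in G (verts G) T" "T \<noteq> {}"
  obtains S where "S \<subseteq> T" "closed_in G (verts G) S" "S \<in> connected_sets G"
proof -
  let ?P = "\<lambda>S. S \<subseteq> T \<and> closed_in G (verts G) S \<and> S \<noteq> {}"
  obtain S where S: "?P S" and min: "\<And>U. ?P U \<Longrightarrow> card S \<le> card U"
    using ex_has_least_nat[of ?P T card] assms by blast
  have fin: "finite S" using S finite_subset[OF _ finite_verts] by (auto simp: closed_in_def)
  have "U = S" if U: "closed_in G S U" "U \<noteq> {}" for U
  proof -
    have "?P U" using S U unfolding closed_in_def by blast
    then show ?thesis using min[of U] U fin by (meson card_seteq closed_in_def)
  qed
  then have "S \<in> connected_sets G" using S by (auto simp: connected_sets_iff closed_in_def)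
  then show thesis using that S by blast
qed

text \<open>An arc from the complement into \<open>T\<close>, when reversed, would leave
  \<open>T\<close>.\<close>

lemma closed_complement: "closed_in G (verts G) T \<Longrightarrow> closed_in G (verts G) (verts G - T)"
  using adj_sym by (auto simp: closed_in_def)

section \<open>Degrees and the exact index\<close>

text \<open>Without parallel arcs, taking heads is a bijection from the arcs leaving
  \<open>v\<close> to its neighbours.\<close>

lemma nbrs_in_verts: "nbrs_in G (verts G) v = out_degree G v"
proof -
  have "{u \<in> verts G. v \<rightarrow>\<^bsub>G\<^esub> u} = head G ` out_arcs G v"
    by (auto simp: arcs_ends_conv)
  moreover have "inj_on (head G) (out_arcs G v)"
    by (rule inj_onI) (auto intro!: no_multi_arcs simp: arc_to_ends_def)
  ultimately show ?thesis by (simp add: nbrs_in_def out_degree_def card_image)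
qed

lemma finite_sub_verts: "S \<subseteq> verts G \<Longrightarrow> finite S"
  using finite_verts by (rule rev_finite_subset)

lemma nbrs_in_complement:
  assumes "S \<subseteq> verts G"
  shows "nbrs_in G S v + nbrs_in G (verts G - S) v = out_degree G v"
proof -
  have "{u \<in> verts G. v \<rightarrow>\<^bsub>G\<^esub> u} = {u \<in> S. v \<rightarrow>\<^bsub>G\<^esub> u} \<union> {u \<in> verts G - S. v \<rightarrow>\<^bsub>G\<^esub> u}"
    using assms by auto
  then have "card {u \<in> verts G. v \<rightarrow>\<^bsub>G\<^esub> u} = card {u \<in> S. v \<rightarrow>\<^bsub>G\<^esub> u} + card {u \<in> verts G - S. v \<rightarrow>\<^bsub>G\<^esub> u}"
    using finite_sub_verts[OF assms] by (simp add: card_Un_disjoint disjoint_iff)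
  then show ?thesis using nbrs_in_verts[of v] by (simp add: nbrs_in_def)
qed

lemma nbrs_in_eq_degree_iff:
  assumes "S \<subseteq> verts G"
  shows "nbrs_in G S v = out_degree G v \<longleftrightarrow> (\<forall>u\<in>verts G. v \<rightarrow>\<^bsub>G\<^esub> u \<longrightarrow> u \<in> S)"
proof -
  have "nbrs_in G S v = out_degree G v \<longleftrightarrow> nbrs_in G (verts G - S) v = 0"
    using nbrs_in_complement[OF assms, of v] by linarith
  also have "\<dots> \<longleftrightarrow> (\<forall>u\<in>verts G. v \<rightarrow>\<^bsub>G\<^esub> u \<longrightarrow> u \<in> S)"
    by (auto simp: nbrs_in_def)
  finally show ?thesis .
qed

lemma degree_le_max: "v \<in> verts G \<Longrightarrow> out_degree G v \<le> max_degree G"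
  by (simp add: max_degree_def)

text \<open>Neighbours outside \<open>S\<close> number the degree minus those inside, so
  \<open>S\<close> is a \<open>k\<close>-alliance exactly when \<open>k\<close> is at most this
  minimum. The minimum lies in the range of admissible \<open>k\<close>, hence is the maximum
  sought.\<close>

lemma exact_index_eq_Min:
  assumes "S \<subseteq> verts G" "S \<noteq> {}"
  shows "exact_index G S = Min ((\<lambda>v. 2 * int (nbrs_in G S v) - int (out_degree G v)) ` S)"
    (is "_ = Min (?d ` S)")
proof -
  have fin: "finite (?d ` S)" using finite_sub_verts[OF assms(1)] by simp
  have d: "?d v = int (nbrs_in G S v) - int (nbrs_in G (verts G - S) v)" for v
    using nbrs_in_complement[OF assms(1), of v] by linarith
  have da: "defensive_alliance G k S \<longleftrightarrow> k \<le> Min (?d ` S)" for k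
  proof -
    have "k \<le> Min (?d ` S) \<longleftrightarrow> (\<forall>v\<in>S. k \<le> ?d v)"
      using fin assms(2) by (subst Min_ge_iff) auto
    then show ?thesis unfolding d defensive_alliance_def using assms by (auto simp: algebra_simps)
  qed
  have "Min (?d ` S) \<in> ?d ` S" using fin assms by (intro Min_in) auto
  then obtain w where w: "w \<in> S" "Min (?d ` S) = ?d w" by blast
  have "nbrs_in G S w \<le> out_degree G w" using nbrs_in_complement[OF assms(1), of w] by linarith
  moreover have "out_degree G w \<le> max_degree G" using w assms by (auto intro: degree_le_max)
  ultimately have m: "- int (max_degree G) \<le> Min (?d ` S)" "Min (?d ` S) \<le> int (max_degree G)"
    unfolding w(2) by linarith+
  show ?thesis unfolding exact_index_def da
    by (rule Max_eqI) (use m in \<open>auto intro: finite_subset[of _ "{- int (max_degree G)..int (max_degree G)}"]\<close>)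
qed

lemma exact_index_le:
  assumes "S \<subseteq> verts G" "v \<in> S"
  shows "exact_index G S \<le> 2 * int (nbrs_in G S v) - int (out_degree G v)"
proof -
  have "S \<noteq> {}" using assms by auto
  then show ?thesis using assms finite_sub_verts[OF assms(1)]
    by (auto simp: exact_index_eq_Min)
qed

lemma exact_index_attained:
  assumes "S \<subseteq> verts G" "S \<noteq> {}"
  obtains v where "v \<in> S" "exact_index G S = 2 * int (nbrs_in G S v) - int (out_degree G v)"
proof -
  have "exact_index G S \<in> (\<lambda>v. 2 * int (nbrs_in G S v) - int (out_degree G v)) ` S"
    unfolding exact_index_eq_Min[OF assms] using assms finite_sub_verts by (intro Min_in) auto
  then show thesis using that by blast
qed

lemma closed_nbrs_in:
  assumes "closed_in G (verts G) S" "v \<in> S"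
  shows "nbrs_in G S v = out_degree G v"
  using assms by (subst nbrs_in_eq_degree_iff) (auto simp: closed_in_def)

lemma max_degree_attained:
  assumes "verts G \<noteq> {}"
  obtains v where "v \<in> verts G" "out_degree G v = max_degree G"
proof -
  have "max_degree G \<in> out_degree G ` verts G"
    unfolding max_degree_def using assms by (intro Max_in) auto
  then show thesis using that by (metis imageE)
qed

lemma max_degree_less_card:
  assumes "verts G \<noteq> {}"
  shows "max_degree G < card (verts G)"
proof -
  obtain v where v: "v \<in> verts G" "out_degree G v = max_degree G"
    using max_degree_attained[OF assms] .
  have "{u \<in> verts G. v \<rightarrow>\<^bsub>G\<^esub> u} \<subset> verts G"
    using v(1) adj_not_same by blast
  then have "nbrs_in G (verts G) v < card (verts G)"
    unfolding nbrs_in_def by (intro psubset_card_mono) auto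
  then show ?thesis using v nbrs_in_verts by simp
qed

lemma exact_index_ge_max_degree:
  assumes "S \<subseteq> verts G" "S \<noteq> {}"
  shows "- int (max_degree G) \<le> exact_index G S"
proof -
  obtain v where v: "v \<in> S" "exact_index G S = 2 * int (nbrs_in G S v) - int (out_degree G v)"
    using exact_index_attained[OF assms] .
  then show ?thesis using degree_le_max[of v] assms by auto
qed

section \<open>Connected sets counted by index, and the coefficients\<close>

lemma index_count_below:
  assumes "k < - int (max_degree G)"
  shows "index_count G k = 0"
proof -
  have "- int (max_degree G) \<le> exact_index G S" if "S \<in> connected_sets G" for S
    using that exact_index_ge_max_degree[of S] by (simp add: connected_sets_def)
  then have "{S \<in> connected_sets G. exact_index G S = k} = {}"
    using assms by (auto simp flip: not_less)
  then show ?thesis by (simp only: index_count_def card.empty)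
qed

lemma coeff_alliance_poly:
  assumes "verts G \<noteq> {}"
  shows "coeff (alliance_poly G) i = int (index_count G (int i - int (card (verts G))))"
proof -
  let ?n = "int (card (verts G))"
  \<comment> \<open>The index is at least minus the maximum degree, which is smaller than the order,
    so the argument of \<open>nat\<close> is positive and \<open>nat\<close> can be
    inverted.\<close>
  have eq: "nat (?n + exact_index G S) = i \<longleftrightarrow> exact_index G S = int i - ?n"
    if "S \<in> connected_sets G" for S
    using that exact_index_ge_max_degree[of S] max_degree_less_card[OF assms]
    by (auto simp: connected_sets_def)
  have "coeff (alliance_poly G) i =
      (\<Sum>S\<in>connected_sets G. if nat (?n + exact_index G S) = i then 1 else 0)"
    by (simp add: alliance_poly_def coeff_sum connected_sets_def)
  also have "\<dots> = (\<Sum>S\<in>connected_sets G. if exact_index G S = int i - ?n then 1 else 0)"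
    using eq by (intro sum.cong) auto
  also have "\<dots> = int (index_count G (int i - ?n))"
    using finite_connected_sets by (simp add: index_count_def flip: sum.inter_filter)
  finally show ?thesis .
qed

lemma nbrs_in_singleton: "nbrs_in G {v} v = 0"
  using adj_not_same by (auto simp: nbrs_in_def)

text \<open>A vertex attaining this index in a connected set has maximum degree and no neighbour in
  the set. It then forms a closed singleton, which is the whole set.\<close>

lemma index_count_minus_max_degree:
  "index_count G (- int (max_degree G)) = card {v \<in> verts G. out_degree G v = max_degree G}"
proof -
  let ?M = "{v \<in> verts G. out_degree G v = max_degree G}"
  have idx1: "exact_index G {v} = - int (out_degree G v)" if "v \<in> verts G" for v
    using that by (simp add: exact_index_eq_Min nbrs_in_singleton)
  have "{S \<in> connected_sets G. exact_index G S = - int (max_degree G)} = (\<lambda>v. {v}) ` ?M"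
  proof (intro set_eqI iffI)
    fix S assume S: "S \<in> {S \<in> connected_sets G. exact_index G S = - int (max_degree G)}"
    then have sub: "S \<subseteq> verts G" "S \<noteq> {}" by (auto simp: connected_sets_def)
    obtain v where v: "v \<in> S" "exact_index G S = 2 * int (nbrs_in G S v) - int (out_degree G v)"
      using exact_index_attained[OF sub] .
    have *: "nbrs_in G S v = 0" "out_degree G v = max_degree G"
      using v S degree_le_max[of v] sub by auto
    have "finite {u \<in> S. v \<rightarrow>\<^bsub>G\<^esub> u}" using finite_sub_verts[OF sub(1)] by simp
    with *(1) have "closed_in G S {v}" using v by (auto simp: nbrs_in_def closed_in_def)
    then have "S = {v}" using S by (auto simp: connected_sets_iff)
    then show "S \<in> (\<lambda>v. {v}) ` ?M" using * sub by auto
  qed (auto simp: singleton_connected idx1)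
  then show ?thesis by (simp add: index_count_def card_image)
qed

lemma index_count_pos_iff:
  "0 < index_count G k \<longleftrightarrow> (\<exists>S\<in>connected_sets G. exact_index G S = k)"
  by (auto simp: index_count_def card_gt_0_iff finite_connected_sets)

lemma index_count_minus_max_degree_pos:
  assumes "verts G \<noteq> {}"
  shows "0 < index_count G (- int (max_degree G))"
proof -
  obtain v where "v \<in> verts G" "out_degree G v = max_degree G"
    using max_degree_attained[OF assms] .
  then show ?thesis by (auto simp: index_count_minus_max_degree card_gt_0_iff)
qed

text \<open>Lets the comparison of two polynomials extend to negative exponents.\<close>

lemma index_count_low:
  assumes "verts G \<noteq> {}" "k \<le> - int (card (verts G))"
  shows "index_count G k = 0"
  using max_degree_less_card[OF assms(1)] assms(2) by (intro index_count_below) linarith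

text \<open>A proper nonempty closed set and its complement would each contain a component, and
  these two are disjoint.\<close>

lemma connected_if_unique_component:
  assumes "verts G \<noteq> {}"
    and "\<And>S T. \<lbrakk>S \<in> connected_sets G; T \<in> connected_sets G;
           closed_in G (verts G) S; closed_in G (verts G) T\<rbrakk> \<Longrightarrow> S = T"
  shows "verts G \<in> connected_sets G"
proof -
  have "T = verts G" if T: "closed_in G (verts G) T" "T \<noteq> {}" for T
  proof (rule ccontr)
    assume "T \<noteq> verts G"
    then have "verts G - T \<noteq> {}" using T by (auto simp: closed_in_def)
    then obtain S where S: "S \<subseteq> verts G - T" "closed_in G (verts G) S" "S \<in> connected_sets G"
      using closed_contains_component[OF closed_complement[OF T(1)]] by blast
    obtain S' where S': "S' \<subseteq> T" "closed_in G (verts G) S'" "S' \<in> connected_sets G"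
      using closed_contains_component[OF T] .
    have "S = S'" using assms(2) S S' by blast
    then show False using S S' by (auto simp: connected_sets_def)
  qed
  then show ?thesis using assms(1) by (auto simp: connected_sets_iff)
qed

end

section \<open>Recognising the cycle up to isomorphism\<close>

text \<open>In a pair digraph an arc is the pair of its ends, so the vertex map determines the arc
  map; this is injective because \<open>G\<close> has no parallel arcs.\<close>

lemma (in nomulti_digraph) digraph_iso_with_projI:
  assumes bij: "bij_betw g (verts G) (pverts H)"
    and adj: "\<And>u v. \<lbrakk>u \<in> verts G; v \<in> verts G\<rbrakk> \<Longrightarrow> u \<rightarrow>\<^bsub>G\<^esub> v \<longleftrightarrow> (g u, g v) \<in> parcs H"
    and H: "parcs H \<subseteq> pverts H \<times> pverts H"
  shows "digraph_iso G (with_proj H)"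
proof -
  let ?h = "\<lparr>iso_verts = g, iso_arcs = (\<lambda>e. (g (tail G e), g (head G e))),
    iso_head = snd, iso_tail = fst\<rparr>"
  have inj: "inj_on g (verts G)" and im: "g ` verts G = pverts H"
    using bij by (auto simp: bij_betw_def)
  have "inj_on (iso_arcs ?h) (arcs G)"
  proof (rule inj_onI)
    fix a b assume "a \<in> arcs G" "b \<in> arcs G" "iso_arcs ?h a = iso_arcs ?h b"
    then show "a = b" using no_multi_arcs by (simp add: arc_to_ends_def inj_on_eq_iff[OF inj])
  qed
  then have "digraph_isomorphism ?h"
    using inj wf_digraph_axioms by (simp add: digraph_isomorphism_def)
  moreover have "with_proj H = app_iso ?h G"
  proof -
    have "parcs H = (\<lambda>e. (g (tail G e), g (head G e))) ` arcs G"
    proof (intro set_eqI iffI)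
      fix e assume e: "e \<in> parcs H"
      then have "fst e \<in> g ` verts G" "snd e \<in> g ` verts G" using H im by auto
      then obtain u v where uv: "u \<in> verts G" "v \<in> verts G" "fst e = g u" "snd e = g v" by blast
      then have "u \<rightarrow>\<^bsub>G\<^esub> v" using adj e by (metis prod.collapse)
      then show "e \<in> (\<lambda>e. (g (tail G e), g (head G e))) ` arcs G"
        using uv by (auto simp: image_iff prod_eq_iff)
    next
      fix e assume "e \<in> (\<lambda>e. (g (tail G e), g (head G e))) ` arcs G"
      then obtain a where a: "a \<in> arcs G" "e = (g (tail G a), g (head G a))" by blast
      then have "tail G a \<rightarrow>\<^bsub>G\<^esub> head G a" by (auto simp: arcs_ends_conv)
      then show "e \<in> parcs H" using a adj by simp
    qed
    then show ?thesis using im by (simp add: app_iso_def with_proj_def)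
  qed
  ultimately show ?thesis unfolding digraph_iso_def by blast
qed

lemma Suc_mod_eq_if: "i < t \<Longrightarrow> Suc i mod t = (if Suc i = t then 0 else Suc i)"
  by auto

text \<open>The case distinction replaces \<open>mod\<close>, so that automation can split on the
  wrap-around.\<close>

lemma parcs_cycle_graph:
  "parcs (cycle_graph t) = {(i, j). i < t \<and> j < t \<and>
    (j = (if Suc i = t then 0 else Suc i) \<or> i = (if Suc j = t then 0 else Suc j))}"
  unfolding cycle_graph_def by (auto simp: Suc_mod_eq_if)

lemma (in graph) connected_2_regular_iso_cycle:
  assumes conn: "verts G \<in> connected_sets G"
    and reg: "\<And>v. v \<in> verts G \<Longrightarrow> out_degree G v = 2"
  shows "digraph_iso G (with_proj (cycle_graph (card (verts G))))"
proof -
  let ?N = "\<lambda>v. {u \<in> verts G. v \<rightarrow>\<^bsub>G\<^esub> u}"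
  have cN: "card (?N v) = 2" if "v \<in> verts G" for v
    using reg[OF that] nbrs_in_verts[of v] by (simp add: nbrs_in_def)
  \<comment> \<open>Two distinct neighbours exhaust a neighbourhood of size 2.\<close>
  have N_eq: "w = x \<or> w = y"
    if "v \<rightarrow>\<^bsub>G\<^esub> x" "v \<rightarrow>\<^bsub>G\<^esub> y" "x \<noteq> y" "v \<rightarrow>\<^bsub>G\<^esub> w" for v w x y
  proof -
    have "{x, y} \<subseteq> ?N v" and w: "w \<in> ?N v" using that adj_in_verts by auto
    moreover have "card {x, y} = card (?N v)" using that cN adj_in_verts by simp
    ultimately have "{x, y} = ?N v" by (intro card_subset_eq) auto
    then show ?thesis using w by blast
  qed
  txt \<open>Walk through the graph without ever turning back; the first repeated vertex is the initial one.\<close>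
  obtain v0 where v0: "v0 \<in> verts G" using conn by (auto simp: connected_sets_def)
  have other: "\<exists>w. v \<rightarrow>\<^bsub>G\<^esub> w \<and> w \<noteq> u" if "v \<in> verts G" for u v
  proof (rule ccontr)
    assume "\<nexists>w. v \<rightarrow>\<^bsub>G\<^esub> w \<and> w \<noteq> u"
    then have "?N v \<subseteq> {u}" by blast
    then have "card (?N v) \<le> card {u}" by (intro card_mono) auto
    then show False using cN[OF that] by simp
  qed
  \<comment> \<open>The state \<open>g n\<close> is an arc of the walk rather than a vertex: the
    previous vertex must be remembered to forbid turning back.\<close>
  have "\<exists>g. \<forall>n. (case g n of (u, v) \<Rightarrow> u \<rightarrow>\<^bsub>G\<^esub> v) \<and>
      (fst (g (Suc n)) = snd (g n) \<and> snd (g (Suc n)) \<noteq> fst (g n))"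
  proof (rule dependent_nat_choice)
    show "\<exists>x. case x of (u, v) \<Rightarrow> u \<rightarrow>\<^bsub>G\<^esub> v"
      using other[OF v0, of v0] by (auto intro!: exI[of _ "(v0, _)"])
  next
    fix x :: "'a \<times> 'a" and n :: nat
    assume "case x of (u, v) \<Rightarrow> u \<rightarrow>\<^bsub>G\<^esub> v"
    then have "snd x \<in> verts G" using adj_in_verts by (cases x) auto
    then obtain w where "snd x \<rightarrow>\<^bsub>G\<^esub> w" "w \<noteq> fst x" using other by blast
    then show "\<exists>y. (case y of (u, v) \<Rightarrow> u \<rightarrow>\<^bsub>G\<^esub> v) \<and> fst y = snd x \<and> snd y \<noteq> fst x"
      by (intro exI[of _ "(snd x, w)"]) auto
  qed
  then obtain g where g: "\<And>n. fst (g n) \<rightarrow>\<^bsub>G\<^esub> snd (g n)"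
      "\<And>n. fst (g (Suc n)) = snd (g n)" "\<And>n. snd (g (Suc n)) \<noteq> fst (g n)"
    by (auto simp: case_prod_beta)
  define f where "f n = fst (g n)" for n
  have step: "f n \<rightarrow>\<^bsub>G\<^esub> f (Suc n)" and no_return: "f (Suc (Suc n)) \<noteq> f n" for n
    using g[of n] g(2)[of "Suc n"] by (simp_all add: f_def)
  have fV: "f n \<in> verts G" for n using step adj_in_verts by blast
  have N_f: "w = f n \<or> w = f (Suc (Suc n))" if "f (Suc n) \<rightarrow>\<^bsub>G\<^esub> w" for n w
    using N_eq[of "f (Suc n)" "f n" "f (Suc (Suc n))" w] step[of n] step[of "Suc n"] no_return[of n] that
    adj_sym by metis
  have "finite (range f)" using fV by (intro finite_subset[OF _ finite_verts]) auto
  then have "\<not> inj f" using finite_imageD[of f UNIV] by auto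
  then obtain l m where ab: "l < m" "f m = f l" by (metis injI linorder_neqE_nat)
  \<comment> \<open>The first time at which an earlier vertex recurs; minimality makes
    \<open>f\<close> injective below \<open>p\<close>.\<close>
  define p where "p = (LEAST p. f p \<in> f ` {..<p})"
  have p: "f p \<in> f ` {..<p}"
    unfolding p_def by (rule LeastI[of _ m]) (use ab in auto)
  have inj: "inj_on f {..<p}"
  proof (rule linorder_inj_onI)
    fix i j assume "i < j" "i \<in> {..<p}" "j \<in> {..<p}"
    then have "f j \<notin> f ` {..<j}" unfolding p_def using not_less_Least by auto
    then show "f i \<noteq> f j" using \<open>i < j\<close> by (metis imageI lessThan_iff)
  qed auto
  have eqD: "i = j" if "f i = f j" "i < p" "j < p" for i j
    using inj_onD[OF inj] that by auto
  obtain j where j: "j < p" "f p = f j" using p by auto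
  then obtain q where q: "p = Suc q" by (cases p) auto
  have loop: "f n \<noteq> f (Suc n)" for n using step[of n] adj_not_same by metis
  \<comment> \<open>Otherwise \<open>f q\<close>, the vertex before \<open>f p = f j\<close>, is one
    of the two walk neighbours of \<open>f j\<close>. By injectivity below \<open>p\<close> this
    contradicts \<open>j < p\<close>, makes the walk turn back, or produces a loop.\<close>
  have "j = 0"
  proof (rule ccontr)
    assume "j \<noteq> 0"
    then obtain i where i: "j = Suc i" by (cases j) auto
    have "f (Suc i) \<rightarrow>\<^bsub>G\<^esub> f q" using step[of q] j i q adj_sym by simp
    then consider "f q = f i" | "f q = f (Suc (Suc i))" using N_f by blast
    then show False
    proof cases
      case 1
      then show False using eqD[of q i] i j q by simp
    next
      case 2
      show False
      proof (cases "Suc (Suc i) < p")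
        case True
        then have "p = Suc (Suc j)" using 2 eqD[of q "Suc (Suc i)"] i q by simp
        then show False using j no_return by simp
      next
        case False
        then have "q = j" using i j q by simp
        then show False using j q loop[of q] by simp
      qed
    qed
  qed
  then have f0: "f p = f 0" using j by simp
  have p3: "3 \<le> p"
  proof -
    have "p \<noteq> 0" "p \<noteq> 1" "p \<noteq> 2"
      using j f0 loop[of 0] no_return[of 0] by (auto simp: numeral_2_eq_2)
    then show ?thesis by simp
  qed
  have fstep: "f i \<rightarrow>\<^bsub>G\<^esub> f ((i + 1) mod p)" if "i < p" for i
    using step[of i] f0 that by (auto simp: Suc_mod_eq_if)
  \<comment> \<open>\<open>N_f\<close> needs a predecessor in the walk; for \<open>f 0\<close> it is
    \<open>f (p - 1)\<close>, which differs from \<open>f 1\<close> since \<open>p\<close> is at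
    least 3.\<close>
  have N0: "w = f 1 \<or> w = f (p - 1)" if "f 0 \<rightarrow>\<^bsub>G\<^esub> w" for w
  proof (rule N_eq[OF _ _ _ that])
    show "f 0 \<rightarrow>\<^bsub>G\<^esub> f 1" using step[of 0] by simp
    show "f 0 \<rightarrow>\<^bsub>G\<^esub> f (p - 1)" using step[of q] f0 q adj_sym by simp
    show "f 1 \<noteq> f (p - 1)" using eqD[of 1 "p - 1"] p3 by auto
  qed
  have N_f': "\<exists>j<p. w = f j \<and> (j = (i + 1) mod p \<or> i = (j + 1) mod p)"
    if i: "i < p" and w: "f i \<rightarrow>\<^bsub>G\<^esub> w" for i w
  proof (cases i)
    case 0
    then show ?thesis using N0[of w] w p3 by (auto intro: exI[of _ 1] exI[of _ "p - 1"])
  next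
    case (Suc i')
    then consider "w = f i'" | "w = f (Suc i)" using N_f w by blast
    then show ?thesis
    proof cases
      case 1
      then show ?thesis using Suc i by (intro exI[of _ i']) auto
    next
      case 2
      then have "w = f ((i + 1) mod p)" using f0 i by (auto simp: Suc_mod_eq_if)
      then show ?thesis using i by (intro exI[of _ "(i + 1) mod p"]) auto
    qed
  qed
  \<comment> \<open>No arc leaves the closed walk, so connectedness makes it cover all vertices; the
    isomorphism is the inverse of \<open>f\<close>.\<close>
  have "closed_in G (verts G) (f ` {..<p})"
    using fV N_f' by (fastforce simp: closed_in_def)
  then have V: "f ` {..<p} = verts G" using conn j by (auto simp: connected_sets_iff)
  then have card: "card (verts G) = p" using card_image[OF inj] by simp
  have bij: "bij_betw (the_inv_into {..<p} f) (verts G) {..<p}"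
    using V inj by (intro bij_betw_the_inv_into) (auto simp: bij_betw_def)
  have adj: "f i \<rightarrow>\<^bsub>G\<^esub> f j \<longleftrightarrow> j = (i + 1) mod p \<or> i = (j + 1) mod p"
    if ij: "i < p" "j < p" for i j
  proof
    assume "f i \<rightarrow>\<^bsub>G\<^esub> f j"
    then obtain k where "k < p" "f j = f k" "k = (i + 1) mod p \<or> i = (k + 1) mod p"
      using N_f' ij by blast
    then show "j = (i + 1) mod p \<or> i = (j + 1) mod p" using eqD ij by blast
  next
    assume "j = (i + 1) mod p \<or> i = (j + 1) mod p"
    then show "f i \<rightarrow>\<^bsub>G\<^esub> f j" using fstep ij adj_sym by blast
  qed
  show ?thesis
  proof (rule digraph_iso_with_projI)
    show "bij_betw (the_inv_into {..<p} f) (verts G) (pverts (cycle_graph (card (verts G))))"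
      using bij card by (simp add: cycle_graph_def)
    show "parcs (cycle_graph (card (verts G))) \<subseteq>
        pverts (cycle_graph (card (verts G))) \<times> pverts (cycle_graph (card (verts G)))"
      by (auto simp: cycle_graph_def)
    fix u v assume "u \<in> verts G" "v \<in> verts G"
    then obtain i j where ij: "i < p" "j < p" "u = f i" "v = f j" using V by blast
    then have "the_inv_into {..<p} f u = i" "the_inv_into {..<p} f v = j"
      using inj by (auto simp: the_inv_into_f_f)
    then show "u \<rightarrow>\<^bsub>G\<^esub> v \<longleftrightarrow>
        (the_inv_into {..<p} f u, the_inv_into {..<p} f v) \<in> parcs (cycle_graph (card (verts G)))"
      using ij adj card by (simp add: cycle_graph_def)
  qed
qed

section \<open>Degrees, connectedness and indices of the cycle\<close>

lemma graph_cycle_graph: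
  assumes "3 \<le> t"
  shows "graph (with_proj (cycle_graph t))"
proof unfold_locales
  have "parcs (cycle_graph t) \<subseteq> {..<t} \<times> {..<t}" by (auto simp: cycle_graph_def)
  then show "finite (arcs (with_proj (cycle_graph t)))"
    using finite_subset by fastforce
  show "symmetric (with_proj (cycle_graph t))"
    by (auto simp: symmetric_def sym_def cycle_graph_def)
  show "tail (with_proj (cycle_graph t)) e \<noteq> head (with_proj (cycle_graph t)) e"
    if "e \<in> arcs (with_proj (cycle_graph t))" for e
    using that assms by (auto simp: parcs_cycle_graph split: if_splits)
qed (auto simp: cycle_graph_def arc_to_ends_def)

context
  fixes t :: nat
  assumes t: "3 \<le> t"
begin

interpretation C: graph "with_proj (cycle_graph t)"
  by (rule graph_cycle_graph[OF t])

lemma out_degree_cycle_graph: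
  assumes "v < t"
  shows "out_degree (with_proj (cycle_graph t)) v = 2"
proof -
  \<comment> \<open>Successor and predecessor modulo \<open>t\<close>, distinct because
    \<open>t\<close> is at least 3.\<close>
  have "{u. u < t \<and> (v, u) \<in> parcs (cycle_graph t)} =
      {if v + 1 = t then 0 else v + 1, if v = 0 then t - 1 else v - 1}"
    using assms t by (auto simp: parcs_cycle_graph split: if_splits)
  then have "nbrs_in (with_proj (cycle_graph t)) (verts (with_proj (cycle_graph t))) v = 2"
    using assms t by (simp add: nbrs_in_def cycle_graph_def)
  then show ?thesis by (simp only: C.nbrs_in_verts)
qed

lemma max_degree_cycle_graph: "max_degree (with_proj (cycle_graph t)) = 2"
proof -
  have "{..<t} \<noteq> {}" using t by (auto simp: lessThan_empty_iff)
  then have "out_degree (with_proj (cycle_graph t)) ` {..<t} = {2}"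
    using out_degree_cycle_graph by (auto simp: image_iff)
  then show ?thesis by (simp add: max_degree_def cycle_graph_def)
qed

lemma connected_cycle_graph: "{..<t} \<in> connected_sets (with_proj (cycle_graph t))"
proof -
  have "T = {..<t}" if T: "closed_in (with_proj (cycle_graph t)) {..<t} T" "T \<noteq> {}" for T
  proof -
    obtain j where j: "j \<in> T" "j < t" using T by (auto simp: closed_in_def)
    \<comment> \<open>A closed set follows successor arcs; \<open>i\<close> is reached from
      \<open>j\<close> after \<open>i + (t - j)\<close> of them.\<close>
    have "(j + k) mod t \<in> T" for k
    proof (induction k)
      case (Suc k)
      have "((j + k) mod t, (j + Suc k) mod t) \<in> parcs (cycle_graph t)"
        using t by (simp add: cycle_graph_def mod_Suc_eq)
      then show ?case using T Suc t by (auto simp: closed_in_def)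
    qed (use j in simp)
    moreover have "i = (j + (i + (t - j))) mod t" if "i < t" for i
      using that j by simp
    ultimately have "i \<in> T" if "i < t" for i using that by metis
    then show ?thesis using T by (auto simp: closed_in_def)
  qed
  then show ?thesis using t C.connected_sets_iff[of "{..<t}"]
    by (auto simp: cycle_graph_def lessThan_empty_iff)
qed

text \<open>All degrees are 2, so the index is twice an inner degree from 0 to 2, minus 2. Index 2
  means that no arc leaves \<open>S\<close>, and the cycle is connected.\<close>

lemma exact_index_cycle_graph:
  assumes S: "S \<in> connected_sets (with_proj (cycle_graph t))"
  shows "exact_index (with_proj (cycle_graph t)) S \<in> {-2, 0, 2}"
    and "exact_index (with_proj (cycle_graph t)) S = 2 \<longleftrightarrow> S = {..<t}"
proof -
  let ?C = "with_proj (cycle_graph t)"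
  have sub: "S \<subseteq> verts ?C" "S \<noteq> {}" using S by (auto simp: connected_sets_def)
  have deg: "out_degree ?C v = 2" if "v \<in> S" for v
    using that sub by (intro out_degree_cycle_graph) (auto simp: cycle_graph_def)
  have nbrs: "nbrs_in ?C S v \<le> 2" if "v \<in> S" for v
    using C.nbrs_in_complement[of S v] sub deg[OF that] by simp
  obtain v where v: "v \<in> S" "exact_index ?C S = 2 * int (nbrs_in ?C S v) - int (out_degree ?C v)"
    using C.exact_index_attained sub by auto
  have "nbrs_in ?C S v \<in> {0, 1, 2}" using nbrs[OF v(1)] by auto
  then show "exact_index ?C S \<in> {-2, 0, 2}" using v deg by auto
  show "exact_index ?C S = 2 \<longleftrightarrow> S = {..<t}"
  proof
    assume idx: "exact_index ?C S = 2"
    have "nbrs_in ?C S u = out_degree ?C u" if "u \<in> S" for u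
      using C.exact_index_le[of S u] sub that idx deg[OF that] nbrs[OF that] by simp
    then have "closed_in ?C {..<t} S"
      using C.nbrs_in_eq_degree_iff sub by (auto simp: closed_in_def cycle_graph_def)
    moreover have "verts ?C = {..<t}" by (simp add: cycle_graph_def)
    ultimately show "S = {..<t}"
      using connected_cycle_graph sub C.connected_sets_iff by blast
  next
    assume "S = {..<t}"
    then have "nbrs_in ?C S v = 2"
      using C.nbrs_in_verts[of v] deg[OF v(1)] by (simp add: cycle_graph_def)
    then show "exact_index ?C S = 2" using v deg by simp
  qed
qed

text \<open>These facts are all that is used about the polynomial of the cycle.\<close>

lemma index_count_cycle_graph:
  shows "index_count (with_proj (cycle_graph t)) (-2) = t"
    and "index_count (with_proj (cycle_graph t)) 2 = 1"
    and "0 < index_count (with_proj (cycle_graph t)) k \<Longrightarrow> k \<in> {-2, 0, 2}"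
proof -
  let ?C = "with_proj (cycle_graph t)"
  have "{v \<in> verts ?C. out_degree ?C v = max_degree ?C} = {..<t}"
    using out_degree_cycle_graph max_degree_cycle_graph by (auto simp: cycle_graph_def)
  then show "index_count ?C (-2) = t"
    using C.index_count_minus_max_degree by (simp add: max_degree_cycle_graph)
  have "{S \<in> connected_sets ?C. exact_index ?C S = 2} = {{..<t}}"
    using exact_index_cycle_graph(2) connected_cycle_graph by auto
  then show "index_count ?C 2 = 1" by (simp add: index_count_def)
  assume "0 < index_count ?C k"
  then obtain S where "S \<in> connected_sets ?C" "exact_index ?C S = k"
    using C.index_count_pos_iff by auto
  then show "k \<in> {-2, 0, 2}" using exact_index_cycle_graph(1) by metis
qed

end

section \<open>Graphs with the same alliance polynomial\<close>

text \<open>Equal coefficients match the counts at a common exponent \<open>k\<close>. The orders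
  may differ, so indices correspond only up to a shift; for negative \<open>k\<close> both counts
  vanish.\<close>

lemma index_count_eq_if_alliance_poly_eq:
  assumes "graph G" "graph H" "verts G \<noteq> {}" "verts H \<noteq> {}"
    and "alliance_poly G = alliance_poly H"
  shows "index_count G (k - int (card (verts G))) = index_count H (k - int (card (verts H)))"
proof (cases "0 \<le> k")
  case True
  then show ?thesis
    using graph.coeff_alliance_poly[OF assms(1,3), of "nat k"]
      graph.coeff_alliance_poly[OF assms(2,4), of "nat k"] assms(5) by simp
next
  case False
  then show ?thesis
    using graph.index_count_low[OF assms(1,3)] graph.index_count_low[OF assms(2,4)] by simp
qed

theorem theorem3p6:
  fixes \<Gamma> :: "('a, 'b) pre_digraph" and t :: nat
  assumes "t \<ge> 3"
    and "graph \<Gamma>"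
    and "verts \<Gamma> \<noteq> {}"
    and "alliance_poly \<Gamma> = alliance_poly (with_proj (cycle_graph t))"
  shows "digraph_iso \<Gamma> (with_proj (cycle_graph t))"
proof -
  interpret graph \<Gamma> by fact
  let ?C = "with_proj (cycle_graph t)"
  define n where "n = card (verts \<Gamma>)"
  define \<Delta> where "\<Delta> = max_degree \<Gamma>"
  have vC: "verts ?C \<noteq> {}" "card (verts ?C) = t"
    using \<open>t \<ge> 3\<close> by (auto simp: cycle_graph_def lessThan_empty_iff)
  have "index_count \<Gamma> (k - int n) = index_count ?C (k - int t)" for k
    using index_count_eq_if_alliance_poly_eq[OF assms(2) graph_cycle_graph[OF assms(1)] assms(3) vC(1) assms(4)]
    unfolding n_def vC by simp
  from this[of "_ + int n"]
  have count: "index_count \<Gamma> k = index_count ?C (k + int n - int t)" for k by simp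
  note cycle_count = index_count_cycle_graph[OF assms(1)]
  \<comment> \<open>The index \<open>- \<Delta>\<close> occurs in \<Gamma>, so its shifted value
    occurs in the cycle. For the reverse inequality, the index -2 of the cycle must not correspond
    to a value below \<open>- \<Delta>\<close>.\<close>
  have "int n - int \<Delta> - int t \<ge> -2"
    using index_count_minus_max_degree_pos[OF assms(3)] cycle_count(3)[of "int n - int \<Delta> - int t"]
    by (auto simp: count \<Delta>_def algebra_simps)
  moreover have "int n - int \<Delta> - int t \<le> -2"
  proof (rule ccontr)
    assume "\<not> ?thesis"
    then have "index_count \<Gamma> (int t - 2 - int n) = 0" by (intro index_count_below) (simp add: \<Delta>_def)
    then show False using cycle_count(1) \<open>t \<ge> 3\<close> by (simp add: count)
  qed
  ultimately have \<Delta>: "int \<Delta> = int n - int t + 2" by linarith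
  have max_deg: "card {v \<in> verts \<Gamma>. out_degree \<Gamma> v = \<Delta>} = t"
    using index_count_minus_max_degree cycle_count(1) by (simp add: count \<Delta> flip: \<Delta>_def)
  have "t \<le> n"
    unfolding max_deg[symmetric] n_def by (rule card_mono) auto
  have idx: "exact_index \<Gamma> S \<in> {- int \<Delta>, 2 - int \<Delta>, 4 - int \<Delta>}" if "S \<in> connected_sets \<Gamma>" for S
  proof -
    have "0 < index_count \<Gamma> (exact_index \<Gamma> S)" using that index_count_pos_iff by blast
    then have "exact_index \<Gamma> S + int n - int t \<in> {-2, 0, 2}" 
      using cycle_count(3)[of "exact_index \<Gamma> S + int n - int t"] by (simp only: count)
    then show ?thesis using \<Delta> by auto
  qed
  have "index_count \<Gamma> (4 - int \<Delta>) = 1" using cycle_count(2) by (simp add: count \<Delta>)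
  then have unique: "S = T" if "S \<in> connected_sets \<Gamma>" "T \<in> connected_sets \<Gamma>"
      "exact_index \<Gamma> S = 4 - int \<Delta>" "exact_index \<Gamma> T = 4 - int \<Delta>" for S T
    using that by (auto simp: index_count_def card_1_singleton_iff)
  have regular: "out_degree \<Gamma> v = 2" if "\<Delta> = 2" "v \<in> verts \<Gamma>" for v
  proof -
    have "{v \<in> verts \<Gamma>. out_degree \<Gamma> v = \<Delta>} = verts \<Gamma>"
      using max_deg \<Delta> that(1) by (intro card_subset_eq) (auto simp: n_def)
    then show ?thesis using that by blast
  qed
  have component: "exact_index \<Gamma> S = 4 - int \<Delta>" (is ?idx) "\<exists>v\<in>S. int (out_degree \<Gamma> v) = 4 - int \<Delta>"
    if S: "S \<in> connected_sets \<Gamma>" "closed_in \<Gamma> (verts \<Gamma>) S" for S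
  proof -
    have sub: "S \<subseteq> verts \<Gamma>" "S \<noteq> {}" using S by (auto simp: connected_sets_def)
    obtain v where v: "v \<in> S" "exact_index \<Gamma> S = 2 * int (nbrs_in \<Gamma> S v) - int (out_degree \<Gamma> v)"
      using exact_index_attained[OF sub] .
    then have deg: "exact_index \<Gamma> S = int (out_degree \<Gamma> v)" using closed_nbrs_in S by simp
    \<comment> \<open>The index is a degree, hence nonnegative. For \<open>\<Delta> \<ge> 3\<close>
      this leaves only \<open>4 - \<Delta>\<close>; for \<open>\<Delta> = 2\<close> the value 0 has
      to be excluded by regularity.\<close>
    show ?idx
    proof (cases "\<Delta> = 2")
      case True
      then show ?thesis using deg regular v sub by auto
    next
      case False
      then have "\<Delta> \<ge> 3" using \<Delta> \<open>t \<le> n\<close> by linarith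
      then show ?thesis using idx[OF S(1)] deg by auto
    qed
    then show "\<exists>v\<in>S. int (out_degree \<Gamma> v) = 4 - int \<Delta>" using v deg by auto
  qed
  then have conn: "verts \<Gamma> \<in> connected_sets \<Gamma>"
    using unique assms(3) by (intro connected_if_unique_component) blast+
  have closed: "closed_in \<Gamma> (verts \<Gamma>) (verts \<Gamma>)" by (auto simp: closed_in_def)
  obtain x where x: "x \<in> verts \<Gamma>" "int (out_degree \<Gamma> x) = 4 - int \<Delta>"
    using component(2)[OF conn closed] by blast
  consider "\<Delta> = 2" | "\<Delta> = 3" | "\<Delta> = 4" using x \<Delta> \<open>t \<le> n\<close> by linarith
  then show ?thesis
  proof cases
    case 1
    then have "n = t" using \<Delta> by simp
    then show ?thesis
      using connected_2_regular_iso_cycle[OF conn] regular 1 by (simp add: n_def)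
  next
    case 2
    let ?L = "verts \<Gamma> - {x}"
    have degx: "out_degree \<Gamma> x = 1" using x 2 by simp
    \<comment> \<open>Here \<open>n = t + 1\<close>, so the \<open>t\<close> vertices of maximum
      degree are all vertices except the leaf \<open>x\<close>.\<close>
    have "{v \<in> verts \<Gamma>. out_degree \<Gamma> v = \<Delta>} = ?L"
      using max_deg \<Delta> 2 x degx by (intro card_subset_eq) (auto simp: n_def)
    then have deg: "out_degree \<Gamma> v = 3" if "v \<in> ?L" for v using that 2 by auto
    have "card ?L = t" using \<Delta> 2 x by (simp add: n_def)
    then have "?L \<noteq> {}" using \<open>t \<ge> 3\<close> by (metis card.empty not_numeral_le_zero)
    have "card {u \<in> verts \<Gamma>. x \<rightarrow>\<^bsub>\<Gamma>\<^esub> u} = 1"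
      using nbrs_in_verts[of x] degx by (simp add: nbrs_in_def)
    then obtain y where y: "{u \<in> verts \<Gamma>. x \<rightarrow>\<^bsub>\<Gamma>\<^esub> u} = {y}" by (auto simp: card_1_singleton_iff)
    have leaf: "u = y" if "x \<rightarrow>\<^bsub>\<Gamma>\<^esub> u" for u using y that adj_in_verts by blast
    \<comment> \<open>Removing a leaf keeps the graph connected: a set closed in \<open>?L\<close>
      becomes closed in \<Gamma> after adding \<open>x\<close> if it contains the neighbour
      \<open>y\<close>, and is already closed otherwise.\<close>
    have "T = ?L" if T: "closed_in \<Gamma> ?L T" "T \<noteq> {}" for T
    proof (cases "y \<in> T")
      case True
      then have "closed_in \<Gamma> (verts \<Gamma>) (insert x T)"
        using T x unfolding closed_in_def by (blast dest: leaf)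
      then have "insert x T = verts \<Gamma>" using conn by (auto simp: connected_sets_iff)
      then show ?thesis using T by (auto simp: closed_in_def)
    next
      case False
      have "closed_in \<Gamma> (verts \<Gamma>) T"
        unfolding closed_in_def
      proof (intro conjI ballI impI)
        fix u w assume u: "u \<in> T" and w: "w \<in> verts \<Gamma>" "u \<rightarrow>\<^bsub>\<Gamma>\<^esub> w"
        then have "w \<noteq> x" using False leaf[of u] adj_sym by blast
        then show "w \<in> T" using T(1) u w unfolding closed_in_def by blast
      qed (use T in \<open>auto simp: closed_in_def\<close>)
      then have "T = verts \<Gamma>" using conn T by (auto simp: connected_sets_iff)
      then show ?thesis using T x by (auto simp: closed_in_def)
    qed
    then have L: "?L \<in> connected_sets \<Gamma>" using \<open>?L \<noteq> {}\<close> by (auto simp: connected_sets_iff)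
    obtain v where v: "v \<in> ?L" "exact_index \<Gamma> ?L = 2 * int (nbrs_in \<Gamma> ?L v) - int (out_degree \<Gamma> v)"
      using exact_index_attained[of ?L] \<open>?L \<noteq> {}\<close> by auto
    \<comment> \<open>Each vertex of \<open>?L\<close> loses at most one of its three neighbours, so
      the index is at least \<open>2 * 2 - 3 = 1\<close>, the value already taken by the whole
      vertex set.\<close>
    have "verts \<Gamma> - ?L = {x}" using x by auto
    then have "nbrs_in \<Gamma> ?L v + nbrs_in \<Gamma> {x} v = 3"
      using nbrs_in_complement[of ?L v] deg[OF v(1)] by simp
    moreover have "nbrs_in \<Gamma> {x} v \<le> 1"
      unfolding nbrs_in_def using card_mono[of "{x}" "{u \<in> {x}. v \<rightarrow>\<^bsub>\<Gamma>\<^esub> u}"] by auto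
    ultimately have "exact_index \<Gamma> ?L \<ge> 1" using v deg[OF v(1)] by simp
    then have "exact_index \<Gamma> ?L = 4 - int \<Delta>" using idx[OF L] 2 by auto
    then have "?L = verts \<Gamma>" using unique[OF L conn] component(1)[OF conn closed] by blast
    then show ?thesis using x by blast
  next
    case 3
    \<comment> \<open>An isolated vertex in a connected graph is the only vertex, which contradicts
      the maximum degree 4.\<close>
    then have deg0: "out_degree \<Gamma> x = 0" using x by simp
    then have "nbrs_in \<Gamma> {x} x = out_degree \<Gamma> x" by (simp add: nbrs_in_singleton)
    then have "closed_in \<Gamma> (verts \<Gamma>) {x}"
      using x nbrs_in_eq_degree_iff[of "{x}" x] by (auto simp: closed_in_def)
    then have "verts \<Gamma> = {x}" using conn by (auto simp: connected_sets_iff)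
    moreover obtain w where "w \<in> verts \<Gamma>" "out_degree \<Gamma> w = \<Delta>"
      using max_degree_attained[OF assms(3)] unfolding \<Delta>_def .
    ultimately show ?thesis using deg0 3 by auto
  qed
qed

end
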